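(* The amoeba-Silver forcing $\mathbf{AV}$ satisfies Axiom A.
   Context: A tree is a subset of $2^{<\omega}$ closed under initial segments. For a tree $T$ and $n\in\omega$, $T|n:=\{t\in T: |t|\le n\}$. A tree $T\subseteq 2^{<\omega}$ is perfect if every node of $T$ can be extended to a splitting node of $T$ (a node $t\in T$ with both $t^\frown 0\in T$ and $t^\frown 1\in T$). A perfect tree $T$ is a Silver tree if for all $s,t\in T$ with $|s|=|t|$ and each $i\in\{0,1\}$: $s^\frown i\in T \Leftrightarrow t^\frown i\in T$. For a finite tree $p$, its height is $\mathrm{ht}(p):=\max\{n:\exists t\in p,\ |t|=n\}$. Amoeba-Silver $\mathbf{AV}$ is the poset of all pairs $(p,T)$ such that $T$ is a Silver tree and $p=T|n$ for some $n\in\omega$, ordered by $(p',T')\le(p,T)$ iff $T'\subseteq T$ and $p'|\mathrm{ht}(p)=p$. A forcing $P$ satisfies Axiom A iff there is a sequence $\{\le_n:n\in\omega\}$ of orders on $P$ such that: (1) for all $a,b\in P$ and $n\in\omega$, $b\le_{n+1}a$ implies both $b\le_n a$ and $b\le a$; (2) for every sequence $\langle a_n:n\in\omega\rangle$ in $P$ with $a_{n+1}\le_n a_n$ for all $n$, there is $b\in P$ with $b\le_n a_n$ for all $n\in\omega$; (3) for every maximal antichain $A\subseteq P$, $b\in P$ and $n\in\omega$, there is $b'\le_n b$ such that $\{a\in A: a\text{ is compatible with }b'\}$ is countable. *)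

theory Defs
  imports "HOL-Library.Sublist" "HOL-Library.Countable_Set"
begin

text \<open>
  The tree of all finite binary sequences is the type \<^typ>\<open>bool list\<close>; the one-step extension of
  \<open>t\<close> by \<open>i\<close> is \<open>t @ [i]\<close>, and initial segments are given by \<^const>\<open>prefix\<close>. Trees are required to
  be nonempty: this is needed for the height to make sense, and otherwise the empty set would
  vacuously be a Silver tree.
\<close>

definition is_tree :: "bool list set \<Rightarrow> bool" where
  "is_tree T \<longleftrightarrow> T \<noteq> {} \<and> (\<forall>t\<in>T. \<forall>s. prefix s t \<longrightarrow> s \<in> T)"

definition splitting_node :: "bool list set \<Rightarrow> bool list \<Rightarrow> bool" where
  "splitting_node T t \<longleftrightarrow> t \<in> T \<and> t @ [False] \<in> T \<and> t @ [True] \<in> T"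

definition perfect_tree :: "bool list set \<Rightarrow> bool" where
  "perfect_tree T \<longleftrightarrow> is_tree T \<and> (\<forall>s\<in>T. \<exists>t. prefix s t \<and> splitting_node T t)"

definition silver_tree :: "bool list set \<Rightarrow> bool" where
  "silver_tree T \<longleftrightarrow> perfect_tree T \<and>
     (\<forall>s\<in>T. \<forall>t\<in>T. length s = length t \<longrightarrow> (\<forall>i. s @ [i] \<in> T \<longleftrightarrow> t @ [i] \<in> T))"

definition tree_restrict :: "bool list set \<Rightarrow> nat \<Rightarrow> bool list set" where
  "tree_restrict T n = {t \<in> T. length t \<le> n}"

text \<open>Only meaningful for finite nonempty \<open>p\<close>.\<close>

definition ht :: "bool list set \<Rightarrow> nat" where
  "ht p = Max {n. \<exists>t\<in>p. length t = n}"

definition AV :: "(bool list set \<times> bool list set) set" where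
  "AV = {(p, T). silver_tree T \<and> (\<exists>n. p = tree_restrict T n)}"

text \<open>For this and all other orders below, \<open>(b, a)\<close> in the relation means that \<open>b\<close> is below \<open>a\<close>.\<close>

definition AV_le :: "(bool list set \<times> bool list set) rel" where
  "AV_le = {((p', T'), (p, T)). (p', T') \<in> AV \<and> (p, T) \<in> AV \<and>
              T' \<subseteq> T \<and> tree_restrict p' (ht p) = p}"

definition compatible :: "'a set \<Rightarrow> 'a rel \<Rightarrow> 'a \<Rightarrow> 'a \<Rightarrow> bool" where
  "compatible P le a b \<longleftrightarrow> (\<exists>c\<in>P. (c, a) \<in> le \<and> (c, b) \<in> le)"

definition antichain :: "'a set \<Rightarrow> 'a rel \<Rightarrow> 'a set \<Rightarrow> bool" where
  "antichain P le A \<longleftrightarrow> A \<subseteq> P \<and> (\<forall>a\<in>A. \<forall>b\<in>A. a \<noteq> b \<longrightarrow> \<not> compatible P le a b)"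

definition maximal_antichain :: "'a set \<Rightarrow> 'a rel \<Rightarrow> 'a set \<Rightarrow> bool" where
  "maximal_antichain P le A \<longleftrightarrow>
     antichain P le A \<and> (\<forall>B. antichain P le B \<and> A \<subseteq> B \<longrightarrow> B = A)"

definition axiom_A :: "'a set \<Rightarrow> 'a rel \<Rightarrow> bool" where
  "axiom_A P le \<longleftrightarrow>
     (\<exists>le_n :: nat \<Rightarrow> 'a rel.
        (\<forall>n. partial_order_on P (le_n n)) \<and>
        (\<forall>a\<in>P. \<forall>b\<in>P. \<forall>n. (b, a) \<in> le_n (Suc n) \<longrightarrow> (b, a) \<in> le_n n \<and> (b, a) \<in> le) \<and>
        (\<forall>a :: nat \<Rightarrow> 'a. (\<forall>n. a n \<in> P) \<and> (\<forall>n. (a (Suc n), a n) \<in> le_n n) \<longrightarrow>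
           (\<exists>b\<in>P. \<forall>n. (b, a n) \<in> le_n n)) \<and>
        (\<forall>A. maximal_antichain P le A \<longrightarrow>
           (\<forall>b\<in>P. \<forall>n. \<exists>b'\<in>P. (b', b) \<in> le_n n \<and>
              countable {a \<in> A. compatible P le a b'})))"

lemma silver_tree_UNIV: "silver_tree UNIV"
  by (auto simp: silver_tree_def perfect_tree_def is_tree_def splitting_node_def)

lemma AV_nonempty: "AV \<noteq> {}"
  using silver_tree_UNIV by (auto simp: AV_def)

lemma finite_tree_restrict: "finite (tree_restrict T n)"
proof (rule finite_subset)
  show "tree_restrict T n \<subseteq> {t. set t \<subseteq> UNIV \<and> length t \<le> n}"
    by (auto simp: tree_restrict_def)
  show "finite {t :: bool list. set t \<subseteq> UNIV \<and> length t \<le> n}"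
    by (rule finite_lists_length_le) simp
qed

lemma AV_finite: "(p, T) \<in> AV \<Longrightarrow> finite p"
  by (auto simp: AV_def finite_tree_restrict)

lemma AV_Nil: "(p, T) \<in> AV \<Longrightarrow> [] \<in> p"
  by (auto simp: AV_def tree_restrict_def silver_tree_def perfect_tree_def is_tree_def)

lemma length_le_ht:
  assumes "finite p" "t \<in> p"
  shows "length t \<le> ht p"
proof -
  have eq: "{n. \<exists>t\<in>p. length t = n} = length ` p" by auto
  show ?thesis using assms unfolding ht_def eq by simp
qed

lemma ht_mono:
  assumes "finite q" "p \<subseteq> q" "p \<noteq> {}"
  shows "ht p \<le> ht q"
proof -
  have eq: "{n. \<exists>t\<in>p. length t = n} = length ` p" for p :: "bool list set" by auto
  show ?thesis using assms unfolding ht_def eq by (intro Max_mono) auto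
qed

lemma tree_restrict_ht: "finite p \<Longrightarrow> tree_restrict p (ht p) = p"
  by (auto simp: tree_restrict_def length_le_ht)

lemma perfect_tree_level:
  assumes "perfect_tree T"
  shows "\<exists>t\<in>T. length t = n"
proof (induction n)
  case 0
  have "[] \<in> T" using assms by (auto simp: perfect_tree_def is_tree_def)
  then show ?case by force
next
  case (Suc n)
  then obtain s where s: "s \<in> T" "length s = n" by blast
  then obtain t where t: "prefix s t" "splitting_node T t"
    using assms by (auto simp: perfect_tree_def)
  have "prefix (take (Suc n) (t @ [False])) (t @ [False])"
    by (rule take_is_prefix)
  moreover have "t @ [False] \<in> T" using t by (simp add: splitting_node_def)
  ultimately have "take (Suc n) (t @ [False]) \<in> T"
    using assms by (auto simp: perfect_tree_def is_tree_def)
  moreover have "length (take (Suc n) (t @ [False])) = Suc n"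
    using prefix_length_le[OF t(1)] s(2) by simp
  ultimately show ?case by blast
qed

lemma ht_tree_restrict:
  assumes "perfect_tree T"
  shows "ht (tree_restrict T n) = n"
proof -
  have "{m. \<exists>t\<in>tree_restrict T n. length t = m} = {..n}"
  proof (intro equalityI subsetI)
    fix m assume "m \<in> {..n}"
    moreover obtain t where "t \<in> T" "length t = m" using perfect_tree_level[OF assms] by blast
    ultimately show "m \<in> {m. \<exists>t\<in>tree_restrict T n. length t = m}"
      by (auto simp: tree_restrict_def)
  qed (auto simp: tree_restrict_def)
  then show ?thesis by (simp add: ht_def Max_eq_iff)
qed

lemma AV_le_partial_order: "partial_order_on AV AV_le"
  unfolding partial_order_on_def preorder_on_def
proof (intro conjI)
  show "AV_le \<subseteq> AV \<times> AV" by (auto simp: AV_le_def)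
  show "refl_on AV AV_le"
    by (auto simp only: refl_on_def AV_le_def AV_finite tree_restrict_ht)
  show "antisym AV_le"
    by (rule antisymI) (auto simp: AV_le_def tree_restrict_def)
  show "trans AV_le"
  proof (rule transI)
    fix x y z assume xy: "(x, y) \<in> AV_le" and yz: "(y, z) \<in> AV_le"
    obtain p T q S r R where eq: "x = (p, T)" "y = (q, S)" "z = (r, R)"
      by (metis surj_pair)
    have p: "(p, T) \<in> AV" "T \<subseteq> S" "tree_restrict p (ht q) = q"
      and q: "(q, S) \<in> AV" "(r, R) \<in> AV" "S \<subseteq> R" "tree_restrict q (ht r) = r"
      using xy yz by (auto simp: eq AV_le_def)
    have "r \<subseteq> q" using q(4) by (auto simp: tree_restrict_def)
    then have "ht r \<le> ht q"
      using AV_Nil[OF q(2)] AV_finite[OF q(1)] by (intro ht_mono) auto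
    then have "tree_restrict p (ht r) = tree_restrict (tree_restrict p (ht q)) (ht r)"
      by (auto simp: tree_restrict_def)
    then have "tree_restrict p (ht r) = r" by (simp only: p(3) q(4))
    with p q show "(x, z) \<in> AV_le" by (auto simp: eq AV_le_def)
  qed
qed

end

theory Submission
  imports Defs
begin

text \<open>
  A Silver tree is determined by the function that sends a level \<open>n\<close> to the set of those bits that
  may follow a node of length \<open>n\<close>: any function with nonempty values that takes the value
  \<open>{False, True}\<close> infinitely often arises in this way. In this coding a condition is a pair of a
  number \<open>n\<close> and a level function \<open>L\<close>, and a stronger condition \<open>(m, M)\<close> satisfies \<open>n \<le> m\<close>,
  \<open>M \<le> L\<close> pointwise, and \<open>M = L\<close> below \<open>n\<close>. The forcing thus looks like Mathias forcing: the
  finite stem \<open>L 0, \<dots>, L (n - 1)\<close> is a promise, the rest of \<open>L\<close> is a reservoir.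

  The \<open>k\<close>-th order keeps the number \<open>n\<close>, the stem and the first \<open>k\<close> splitting levels. The
  pointwise intersection of a fusion sequence still splits infinitely often, because the orders
  protect ever more splitting levels (lemma \<open>fusion\<close>).

  For an antichain \<open>A\<close>, call a stem settled by a reservoir if thinning that reservoir
  cannot newly bring the condition below an element of \<open>A\<close>: if some thinning does, then the whole
  reservoir does already. There are finitely many stems of a given length, and settling one of them
  needs at most one thinning, which does not unsettle the others (lemma \<open>settle_length\<close>). By
  fusion, some reservoir \<open>K\<close> settles the stems of infinitely many lengths. If now \<open>a \<in> A\<close> has a common
  extension with the condition given by \<open>K\<close>, lengthen the stem of this extension until it is
  settled: the stem with the full reservoir is below an element of \<open>A\<close>, which must be \<open>a\<close>
  since \<open>A\<close> is an antichain. So a finite stem determines \<open>a\<close> (lemma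
  \<open>AV_fusion_antichain\<close>), and only countably many elements of \<open>A\<close> are compatible with the thinned condition.
\<close>

section \<open>Level functions of Silver trees\<close>

definition splits :: "(nat \<Rightarrow> bool set) \<Rightarrow> nat set" where
  "splits L = {n. L n = UNIV}"

definition silver_levels :: "(nat \<Rightarrow> bool set) \<Rightarrow> bool" where
  "silver_levels L \<longleftrightarrow> (\<forall>n. L n \<noteq> {}) \<and> infinite (splits L)"

definition tree_of :: "(nat \<Rightarrow> bool set) \<Rightarrow> bool list set" where
  "tree_of L = {t. \<forall>k<length t. t ! k \<in> L k}"

lemma Nil_in_tree_of [simp]: "[] \<in> tree_of L"
  by (simp add: tree_of_def)

lemma snoc_in_tree_of [simp]: "t @ [i] \<in> tree_of L \<longleftrightarrow> t \<in> tree_of L \<and> i \<in> L (length t)"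
  by (auto simp: tree_of_def nth_append less_Suc_eq)

lemma tree_of_mono: "M \<le> L \<Longrightarrow> tree_of M \<subseteq> tree_of L"
  by (fastforce simp: tree_of_def le_fun_def)

lemma tree_of_extend:
  assumes "\<forall>n. L n \<noteq> {}" "s \<in> tree_of L" "length s \<le> n"
  shows "\<exists>t\<in>tree_of L. prefix s t \<and> length t = n"
  using assms(3)
proof (induction n rule: dec_induct)
  case base
  show ?case using assms(2) by auto
next
  case (step n)
  then obtain t where t: "t \<in> tree_of L" "prefix s t" "length t = n" by blast
  obtain i where "i \<in> L n" using assms(1) by blast
  then show ?case using t by (intro bexI[of _ "t @ [i]"]) auto
qed

lemma silver_tree_tree_of:
  assumes "silver_levels L"
  shows "silver_tree (tree_of L)"
  unfolding silver_tree_def perfect_tree_def is_tree_def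
proof (intro conjI ballI)
  fix s assume s: "s \<in> tree_of L"
  obtain n where n: "length s \<le> n" "L n = UNIV"
    using assms unfolding silver_levels_def splits_def infinite_nat_iff_unbounded_le by blast
  obtain t where "t \<in> tree_of L" "prefix s t" "length t = n"
    using tree_of_extend[OF _ s n(1)] assms unfolding silver_levels_def by blast
  then show "\<exists>t. prefix s t \<and> splitting_node (tree_of L) t"
    using n(2) by (auto simp: splitting_node_def)
next
  show "tree_of L \<noteq> {}" using Nil_in_tree_of by blast
qed (auto simp: tree_of_def prefix_def nth_append split: if_splits)

text \<open>By the Silver property, the possible successors of a node depend only on its length.\<close>

lemma silver_tree_obtain_levels:
  assumes T: "silver_tree T"
  obtains L where "silver_levels L" "T = tree_of L"
proof
  have perf: "perfect_tree T" using T by (simp add: silver_tree_def)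
  have closed: "s \<in> T" if "t \<in> T" "prefix s t" for s t
    using perf that by (auto simp: perfect_tree_def is_tree_def)
  have Nil: "[] \<in> T" using perf by (auto simp: perfect_tree_def is_tree_def)
  define L where "L n = {i. \<exists>t\<in>T. length t = n \<and> t @ [i] \<in> T}" for n
  have snoc: "t @ [i] \<in> T \<longleftrightarrow> t \<in> T \<and> i \<in> L (length t)" for t i
  proof
    show "t @ [i] \<in> T \<Longrightarrow> t \<in> T \<and> i \<in> L (length t)"
      using closed[of "t @ [i]" t] by (auto simp: L_def)
    show "t \<in> T \<and> i \<in> L (length t) \<Longrightarrow> t @ [i] \<in> T"
      using T unfolding L_def silver_tree_def by blast
  qed
  show "T = tree_of L"
  proof (rule set_eqI)
    show "t \<in> T \<longleftrightarrow> t \<in> tree_of L" for t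
      by (induction t rule: rev_induct) (simp_all add: Nil snoc)
  qed
  have "L n \<noteq> {}" for n
  proof -
    obtain t where t: "t \<in> T" "length t = Suc n" using perfect_tree_level[OF perf] by blast
    then have "t = butlast t @ [last t]" by (metis append_butlast_last_id length_0_conv nat.distinct(1))
    then have "last t \<in> L (length (butlast t))" using snoc t(1) by metis
    then show ?thesis using t(2) by auto
  qed
  moreover have "\<exists>n\<ge>m. n \<in> splits L" for m
  proof -
    obtain s where s: "s \<in> T" "length s = m" using perfect_tree_level[OF perf] by blast
    then obtain t where t: "prefix s t" "splitting_node T t"
      using perf by (auto simp: perfect_tree_def)
    have "i \<in> L (length t)" for i
      using t(2) snoc by (cases i) (auto simp: splitting_node_def)
    then show ?thesis using prefix_length_le[OF t(1)] s(2) by (auto simp: splits_def)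
  qed
  ultimately show "silver_levels L"
    by (simp add: silver_levels_def infinite_nat_iff_unbounded_le)
qed

lemma tree_restrict_subset_tree_of_iff:
  assumes "\<forall>n. M n \<noteq> {}"
  shows "tree_restrict (tree_of M) n \<subseteq> tree_of L \<longleftrightarrow> (\<forall>i<n. M i \<subseteq> L i)"
proof
  assume sub: "tree_restrict (tree_of M) n \<subseteq> tree_of L"
  show "\<forall>i<n. M i \<subseteq> L i"
  proof (intro allI impI subsetI)
    fix i x assume i: "i < n" and x: "x \<in> M i"
    obtain t where "t \<in> tree_of M" "length t = i"
      using tree_of_extend[OF assms Nil_in_tree_of, of i] by auto
    then have "t @ [x] \<in> tree_restrict (tree_of M) n"
      using i x by (auto simp: tree_restrict_def)
    then have "t @ [x] \<in> tree_of L" using sub by blast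
    then show "x \<in> L i" using \<open>length t = i\<close> by simp
  qed
next
  assume "\<forall>i<n. M i \<subseteq> L i"
  then show "tree_restrict (tree_of M) n \<subseteq> tree_of L"
    by (auto simp: tree_restrict_def tree_of_def) (meson less_le_trans subsetD)
qed

lemma tree_of_subset_iff:
  assumes "\<forall>n. M n \<noteq> {}"
  shows "tree_of M \<subseteq> tree_of L \<longleftrightarrow> M \<le> L"
proof
  assume "tree_of M \<subseteq> tree_of L"
  then have "tree_restrict (tree_of M) n \<subseteq> tree_of L" for n
    by (auto simp: tree_restrict_def)
  then show "M \<le> L"
    unfolding le_fun_def using tree_restrict_subset_tree_of_iff[OF assms] lessI by blast
qed (rule tree_of_mono)

lemma tree_restrict_eq_iff:
  assumes "\<forall>n. M n \<noteq> {}" "\<forall>n. L n \<noteq> {}"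
  shows "tree_restrict (tree_of M) n = tree_restrict (tree_of L) n \<longleftrightarrow> (\<forall>i<n. M i = L i)"
proof -
  have "tree_restrict (tree_of M) n = tree_restrict (tree_of L) n \<longleftrightarrow>
    tree_restrict (tree_of M) n \<subseteq> tree_of L \<and> tree_restrict (tree_of L) n \<subseteq> tree_of M"
    by (auto simp: tree_restrict_def)
  then show ?thesis
    unfolding tree_restrict_subset_tree_of_iff[OF assms(1)]
      tree_restrict_subset_tree_of_iff[OF assms(2)]
    by auto
qed

section \<open>Amoeba-Silver forcing in terms of level functions\<close>

definition condition :: "nat \<Rightarrow> (nat \<Rightarrow> bool set) \<Rightarrow> bool list set \<times> bool list set" where
  "condition n L = (tree_restrict (tree_of L) n, tree_of L)"

lemma condition_in_AV: "silver_levels L \<Longrightarrow> condition n L \<in> AV"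
  by (auto simp: condition_def AV_def silver_tree_tree_of)

lemma AV_obtain_condition:
  assumes "c \<in> AV"
  obtains n L where "silver_levels L" "c = condition n L"
proof -
  obtain T n where "silver_tree T" "c = (tree_restrict T n, T)"
    using assms by (auto simp: AV_def)
  then show ?thesis
    using silver_tree_obtain_levels that unfolding condition_def by metis
qed

lemma ht_tree_restrict_tree_of: "silver_levels L \<Longrightarrow> ht (tree_restrict (tree_of L) n) = n"
  using silver_tree_tree_of by (intro ht_tree_restrict) (simp add: silver_tree_def)

lemma condition_eq_iff:
  assumes "silver_levels M" "silver_levels L"
  shows "condition m M = condition n L \<longleftrightarrow> m = n \<and> M = L"
proof
  assume eq: "condition m M = condition n L"
  have ne: "\<forall>n. M n \<noteq> {}" "\<forall>n. L n \<noteq> {}" using assms by (auto simp: silver_levels_def)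
  have "M = L"
    using eq tree_of_subset_iff[OF ne(1)] tree_of_subset_iff[OF ne(2)]
    by (auto simp: condition_def intro: antisym)
  moreover have "m = n"
    using eq ht_tree_restrict_tree_of[OF assms(1), of m] ht_tree_restrict_tree_of[OF assms(2), of n]
    unfolding condition_def by (metis prod.inject)
  ultimately show "m = n \<and> M = L" by simp
qed simp

lemma AV_le_condition_iff:
  assumes "silver_levels M" "silver_levels L"
  shows "(condition m M, condition n L) \<in> AV_le \<longleftrightarrow> n \<le> m \<and> M \<le> L \<and> (\<forall>i<n. M i = L i)"
proof -
  have ne: "\<forall>n. M n \<noteq> {}" "\<forall>n. L n \<noteq> {}" using assms by (auto simp: silver_levels_def)
  have twice: "tree_restrict (tree_restrict (tree_of M) m) n = tree_restrict (tree_of M) (min m n)"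
    by (auto simp: tree_restrict_def)
  have "(condition m M, condition n L) \<in> AV_le \<longleftrightarrow>
      M \<le> L \<and> tree_restrict (tree_of M) (min m n) = tree_restrict (tree_of L) n"
    using condition_in_AV[OF assms(1), of m] condition_in_AV[OF assms(2), of n]
    by (simp add: AV_le_def condition_def ht_tree_restrict_tree_of[OF assms(2)] twice
        tree_of_subset_iff[OF ne(1)])
  \<comment> \<open>Comparing heights: a tree of height \<open>min m n\<close> can only equal one of height \<open>n\<close> if \<open>n \<le> m\<close>.\<close>
  also have "\<dots> \<longleftrightarrow> n \<le> m \<and> M \<le> L \<and> tree_restrict (tree_of M) n = tree_restrict (tree_of L) n"
    using ht_tree_restrict_tree_of[OF assms(1), of "min m n"]
      ht_tree_restrict_tree_of[OF assms(2), of n]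
    by (metis min.absorb2 min.cobounded1)
  finally show ?thesis by (simp only: tree_restrict_eq_iff[OF ne])
qed

lemma AV_le_trans: "(x, y) \<in> AV_le \<Longrightarrow> (y, z) \<in> AV_le \<Longrightarrow> (x, z) \<in> AV_le"
  using AV_le_partial_order by (auto simp: partial_order_on_def preorder_on_def dest: transD)

section \<open>Fusion\<close>

definition first_splits :: "nat \<Rightarrow> (nat \<Rightarrow> bool set) \<Rightarrow> nat set" where
  "first_splits k L = {n \<in> splits L. card (splits L \<inter> {..<n}) < k}"

definition fusion_le :: "nat \<Rightarrow> nat \<Rightarrow> (nat \<Rightarrow> bool set) \<Rightarrow> (nat \<Rightarrow> bool set) \<Rightarrow> bool" where
  "fusion_le n k M L \<longleftrightarrow> silver_levels M \<and> silver_levels L \<and> M \<le> L \<and>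
     (\<forall>i<n. M i = L i) \<and> first_splits k L \<subseteq> splits M"

text \<open>
  The number \<open>n\<close> is the same on both sides: a fusion extends no stem, so that the limit of a fusion
  sequence has a finite stem.
\<close>

definition AV_fusion :: "nat \<Rightarrow> (bool list set \<times> bool list set) rel" where
  "AV_fusion k = {(condition n M, condition n L) | n M L. fusion_le n k M L}"

lemma splits_mono: "M \<le> L \<Longrightarrow> splits M \<subseteq> splits L"
  by (fastforce simp: splits_def le_fun_def)

text \<open>
  Thinning can only lower the rank of a level among the splitting levels, so a protected splitting
  level stays protected. This is what makes the fusion orders transitive.
\<close>

lemma first_splits_persist:
  assumes "fusion_le n k M L" "k \<le> k'"
  shows "first_splits k L \<subseteq> first_splits k' M"
proof
  fix i assume i: "i \<in> first_splits k L"
  have "splits M \<subseteq> splits L" using assms(1) by (simp add: fusion_le_def splits_mono)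
  then have "card (splits M \<inter> {..<i}) \<le> card (splits L \<inter> {..<i})"
    by (intro card_mono) auto
  then show "i \<in> first_splits k' M"
    using i assms by (auto simp: first_splits_def fusion_le_def)
qed

lemma fusion_le_refl: "silver_levels L \<Longrightarrow> fusion_le n k L L"
  by (auto simp: fusion_le_def first_splits_def)

lemma fusion_le_trans: "fusion_le n k M K \<Longrightarrow> fusion_le n k K L \<Longrightarrow> fusion_le n k M L"
  using first_splits_persist[of n k K L k] by (auto simp: fusion_le_def intro: order_trans)

lemma fusion_le_Suc: "fusion_le n (Suc k) M L \<Longrightarrow> fusion_le n k M L"
  by (fastforce simp: fusion_le_def first_splits_def)

lemma AV_fusion_condition_iff:
  assumes "silver_levels M" "silver_levels L"
  shows "(condition m M, condition n L) \<in> AV_fusion k \<longleftrightarrow> m = n \<and> fusion_le n k M L"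
proof
  assume "(condition m M, condition n L) \<in> AV_fusion k"
  then obtain n' M' L' where eq: "condition m M = condition n' M'" "condition n L = condition n' L'"
    and f: "fusion_le n' k M' L'"
    by (auto simp: AV_fusion_def)
  have "silver_levels M'" "silver_levels L'" using f by (auto simp: fusion_le_def)
  then show "m = n \<and> fusion_le n k M L"
    using eq f assms by (simp add: condition_eq_iff)
qed (auto simp: AV_fusion_def)

lemma AV_fusion_le: "(x, y) \<in> AV_fusion k \<Longrightarrow> (x, y) \<in> AV_le"
  by (auto simp: AV_fusion_def AV_le_condition_iff fusion_le_def)

lemma AV_fusion_partial_order: "partial_order_on AV (AV_fusion k)"
  unfolding partial_order_on_def preorder_on_def
proof (intro conjI)
  show "AV_fusion k \<subseteq> AV \<times> AV"
    by (auto simp: AV_fusion_def fusion_le_def condition_in_AV)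
  show "refl_on AV (AV_fusion k)"
    unfolding refl_on_def
    by (metis AV_obtain_condition AV_fusion_condition_iff fusion_le_refl)
  show "antisym (AV_fusion k)"
    using AV_fusion_le AV_le_partial_order unfolding partial_order_on_def
    by (blast intro: antisymI dest: antisymD)
  show "trans (AV_fusion k)"
  proof (rule transI)
    fix x y z assume xy: "(x, y) \<in> AV_fusion k" and yz: "(y, z) \<in> AV_fusion k"
    obtain n M K where x: "x = condition n M" "y = condition n K" "fusion_le n k M K"
      using xy by (auto simp: AV_fusion_def)
    obtain n' L where z: "z = condition n' L" "silver_levels L"
      using yz by (auto simp: AV_fusion_def fusion_le_def)
    have "n = n' \<and> fusion_le n' k K L"
      using yz x z by (simp add: AV_fusion_condition_iff fusion_le_def)
    then show "(x, z) \<in> AV_fusion k"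
      using x z fusion_le_trans unfolding AV_fusion_def by blast
  qed
qed

lemma first_splits_exceeds:
  assumes "silver_levels L" "N < k"
  shows "\<exists>i\<ge>N. i \<in> first_splits k L"
proof -
  have ex: "\<exists>i. N \<le> i \<and> i \<in> splits L"
    using assms(1) by (auto simp: silver_levels_def infinite_nat_iff_unbounded_le)
  \<comment> \<open>All splitting levels below the least one that is at least \<open>N\<close> lie below \<open>N\<close>, so its rank is
    at most \<open>N\<close>.\<close>
  define i where "i = (LEAST i. N \<le> i \<and> i \<in> splits L)"
  have i: "N \<le> i" "i \<in> splits L" using LeastI_ex[OF ex] by (auto simp: i_def)
  have "splits L \<inter> {..<i} \<subseteq> {..<N}"
    unfolding i_def using not_less_Least by fastforce
  then have "card (splits L \<inter> {..<i}) \<le> N"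
    using card_mono[of "{..<N}"] by fastforce
  then show ?thesis using i assms(2) by (auto simp: first_splits_def)
qed

text \<open>
  Only the levels that are protected at some stage are known to survive in the limit. Stage \<open>j\<close>
  protects a splitting level at or above every \<open>N < k + j\<close>, which suffices for infinitely many.
  The offset \<open>k\<close> lets a fusion start below a condition in the \<open>k\<close>-th order.
\<close>

lemma fusion:
  assumes "\<And>j. fusion_le n (k + j) (L (Suc j)) (L j)"
  defines "K \<equiv> \<lambda>i. \<Inter>j. L j i"
  shows "fusion_le n (k + j) K (L j)"
proof -
  have step: "silver_levels (L j)" "L (Suc j) \<le> L j" "i < n \<Longrightarrow> L (Suc j) i = L j i" for i j
    using assms(1)[of j] by (auto simp: fusion_le_def)
  have dec: "L j' \<le> L j" if "j \<le> j'" for j j'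
    using that step(2) by (rule lift_Suc_antimono_le[rotated])
  have persist: "first_splits (k + j) (L j) \<subseteq> first_splits (k + j') (L j')" if "j \<le> j'" for j j'
    using that
  proof (induction j' rule: dec_induct)
    case (step j')
    have "k + j' \<le> k + Suc j'" by simp
    from step.IH first_splits_persist[OF assms(1) this] show ?case by (rule subset_trans)
  qed simp
  have survive: "first_splits (k + j) (L j) \<subseteq> splits K" for j
  proof
    fix i assume i: "i \<in> first_splits (k + j) (L j)"
    have "L j' i = UNIV" for j'
    proof (cases "j \<le> j'")
      case True
      then show ?thesis using persist i by (fastforce simp: first_splits_def splits_def)
    next
      case False
      then have "L j i \<subseteq> L j' i" using dec[of j' j] by (simp add: le_fun_def)
      then show ?thesis using i by (auto simp: first_splits_def splits_def)
    qed
    then show "i \<in> splits K" by (simp add: K_def splits_def)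
  qed
  have "K i \<noteq> {}" for i
  proof
    assume "K i = {}"
    then obtain j j' where "True \<notin> L j i" "False \<notin> L j' i"
      unfolding K_def by (metis INT_I empty_iff)
    moreover have "L (max j j') i \<subseteq> L j i" "L (max j j') i \<subseteq> L j' i"
      using dec[of j "max j j'"] dec[of j' "max j j'"] by (auto simp: le_fun_def)
    ultimately have "b \<notin> L (max j j') i" for b by (cases b) auto
    then have "L (max j j') i = {}" by blast
    then show False using step(1) by (auto simp: silver_levels_def)
  qed
  moreover have "\<exists>i\<ge>N. i \<in> splits K" for N
    using first_splits_exceeds[OF step(1), of N "k + Suc N"] survive by fastforce
  ultimately have "silver_levels K"
    by (simp add: silver_levels_def infinite_nat_iff_unbounded_le)
  moreover have "K \<le> L j" by (auto simp: K_def le_fun_def)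
  moreover have "K i = L j i" if "i < n" for i
  proof -
    have eq: "L j i = L 0 i" for j by (induction j) (simp_all add: step(3) that)
    have "K i = (\<Inter>j::nat. L 0 i)" unfolding K_def by (rule INF_cong[OF refl eq])
    also have "\<dots> = L j i" using eq[of j] by simp
    finally show ?thesis .
  qed
  ultimately show ?thesis using survive step(1) by (simp add: fusion_le_def)
qed

lemma AV_fusion_complete:
  assumes "\<And>j. a j \<in> AV" "\<And>j. (a (Suc j), a j) \<in> AV_fusion j"
  shows "\<exists>b\<in>AV. \<forall>j. (b, a j) \<in> AV_fusion j"
proof -
  have "\<forall>j. \<exists>n L. silver_levels L \<and> a j = condition n L"
    using assms(1) AV_obtain_condition by metis
  then obtain n L where L: "\<And>j. silver_levels (L j)" "\<And>j. a j = condition (n j) (L j)"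
    by metis
  have step: "n (Suc j) = n j" "fusion_le (n j) j (L (Suc j)) (L j)" for j
    using assms(2)[of j] L by (auto simp: AV_fusion_condition_iff)
  have n: "n j = n 0" for j by (induction j) (simp_all add: step)
  define K where "K = (\<lambda>i. \<Inter>j. L j i)"
  have K: "fusion_le (n 0) j K (L j)" for j
  proof -
    have "fusion_le (n 0) (0 + j) (L (Suc j)) (L j)" for j
      using step(2)[of j] n[of j] by simp
    then show ?thesis using fusion[of "n 0" 0 L j] unfolding K_def by (metis add_0)
  qed
  have "(condition (n 0) K, a j) \<in> AV_fusion j" for j
    using K[of j] L n[of j] by (auto simp: AV_fusion_def)
  moreover have "condition (n 0) K \<in> AV"
    using K by (auto simp: fusion_le_def intro: condition_in_AV)
  ultimately show ?thesis by blast
qed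

section \<open>Capturing an antichain\<close>

definition below :: "(bool list set \<times> bool list set) set \<Rightarrow> nat \<Rightarrow> (nat \<Rightarrow> bool set) \<Rightarrow> bool" where
  "below A m M \<longleftrightarrow> (\<exists>a\<in>A. (condition m M, a) \<in> AV_le)"

definition graft :: "bool set list \<Rightarrow> (nat \<Rightarrow> bool set) \<Rightarrow> nat \<Rightarrow> bool set" where
  "graft \<sigma> L i = (if i < length \<sigma> then \<sigma> ! i else L i)"

text \<open>
  Whether \<open>\<sigma>\<close> can be brought below an element of \<open>A\<close> by thinning \<open>L\<close> is already decided by \<open>L\<close>
  itself. A list \<open>\<sigma>\<close> with an empty entry is vacuously settled, since no Silver level function \<open>M\<close>
  agrees with it.
\<close>

definition settled ::
    "(bool list set \<times> bool list set) set \<Rightarrow> bool set list \<Rightarrow> (nat \<Rightarrow> bool set) \<Rightarrow> bool" where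
  "settled A \<sigma> L \<longleftrightarrow>
     (\<forall>M. silver_levels M \<and> M \<le> graft \<sigma> L \<and> (\<forall>i<length \<sigma>. M i = \<sigma> ! i) \<and> below A (length \<sigma>) M
        \<longrightarrow> below A (length \<sigma>) (graft \<sigma> L))"

lemma silver_levels_cong_above:
  assumes "silver_levels L" "\<And>i. M i \<noteq> {}" "\<And>i. m \<le> i \<Longrightarrow> M i = L i"
  shows "silver_levels M"
proof -
  have "\<exists>i\<ge>N. i \<in> splits M" for N
  proof -
    obtain i where "max m N \<le> i" "i \<in> splits L"
      using assms(1) unfolding silver_levels_def infinite_nat_iff_unbounded_le by blast
    then show ?thesis using assms(3) by (intro exI[of _ i]) (auto simp: splits_def)
  qed
  then show ?thesis using assms(2) by (simp add: silver_levels_def infinite_nat_iff_unbounded_le)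
qed

lemma silver_levels_graft:
  assumes "silver_levels L" "silver_levels M" "\<And>i. i < length \<sigma> \<Longrightarrow> M i = \<sigma> ! i"
  shows "silver_levels (graft \<sigma> L)"
proof (rule silver_levels_cong_above[OF assms(1), where m = "length \<sigma>"])
  show "graft \<sigma> L i \<noteq> {}" for i
    using assms by (auto simp: graft_def silver_levels_def) metis
qed (simp add: graft_def)

text \<open>
  A thinning that witnesses the premise for \<open>L'\<close> also does so for \<open>L\<close>, and the conclusion passes
  down from \<open>graft \<sigma> L\<close> to the stronger condition \<open>graft \<sigma> L'\<close>.
\<close>

lemma settled_mono:
  assumes "settled A \<sigma> L" "L' \<le> L" "silver_levels L'" "silver_levels L"
  shows "settled A \<sigma> L'"
  unfolding settled_def
proof (intro allI impI, elim conjE)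
  fix M assume M: "silver_levels M" "M \<le> graft \<sigma> L'" "\<forall>i<length \<sigma>. M i = \<sigma> ! i"
    "below A (length \<sigma>) M"
  have le: "graft \<sigma> L' \<le> graft \<sigma> L" using assms(2) by (auto simp: graft_def le_fun_def)
  then have "below A (length \<sigma>) (graft \<sigma> L)"
    using assms(1) M order_trans[OF M(2) le] by (auto simp: settled_def)
  moreover have "(condition (length \<sigma>) (graft \<sigma> L'), condition (length \<sigma>) (graft \<sigma> L)) \<in> AV_le"
    using M assms(3,4) le silver_levels_graft
    by (subst AV_le_condition_iff) (auto simp: graft_def)
  ultimately show "below A (length \<sigma>) (graft \<sigma> L')"
    unfolding below_def using AV_le_trans by blast
qed

text \<open>
  If \<open>L\<close> does not settle \<open>\<sigma>\<close>, some thinning reaches an element of \<open>A\<close>; with this thinning as the new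
  reservoir, the grafted condition itself is below that element.
\<close>

lemma settle_one:
  assumes L: "silver_levels L"
  shows "\<exists>L'. silver_levels L' \<and> L' \<le> L \<and> (\<forall>i<length \<sigma>. L' i = L i) \<and> settled A \<sigma> L'"
proof (cases "settled A \<sigma> L")
  case False
  then obtain M where M: "silver_levels M" "M \<le> graft \<sigma> L" "\<forall>i<length \<sigma>. M i = \<sigma> ! i"
    "below A (length \<sigma>) M"
    by (auto simp: settled_def)
  define L' where "L' i = (if i < length \<sigma> then L i else M i)" for i
  have "silver_levels L'"
    by (rule silver_levels_cong_above[OF M(1), where m = "length \<sigma>"])
      (use L M(1) in \<open>auto simp: L'_def silver_levels_def\<close>)
  moreover have "L' \<le> L"
    using M(2) by (auto simp: L'_def le_fun_def graft_def split: if_splits)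
  moreover have "graft \<sigma> L' = M" using M(3) by (auto simp: graft_def L'_def fun_eq_iff)
  then have "settled A \<sigma> L'" using M(4) by (simp add: settled_def)
  ultimately show ?thesis by (auto simp: L'_def)
qed (use L in auto)

text \<open>There are finitely many stems of length \<open>m\<close>, and settled stems remain settled under thinning.\<close>

lemma settle_length:
  assumes L: "silver_levels L"
  shows "\<exists>L'. silver_levels L' \<and> L' \<le> L \<and> (\<forall>i<m. L' i = L i) \<and>
           (\<forall>\<sigma>. length \<sigma> = m \<longrightarrow> settled A \<sigma> L')"
proof -
  have "\<exists>L'. silver_levels L' \<and> L' \<le> L \<and> (\<forall>i<m. L' i = L i) \<and> (\<forall>\<sigma>\<in>S. settled A \<sigma> L')"
    if "finite S" "S \<subseteq> {\<sigma>. length \<sigma> = m}" for S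
    using that
  proof (induction S rule: finite_induct)
    case empty
    then show ?case using L by auto
  next
    case (insert \<sigma> S)
    then obtain L1 where L1: "silver_levels L1" "L1 \<le> L" "\<forall>i<m. L1 i = L i"
      "\<forall>\<sigma>\<in>S. settled A \<sigma> L1"
      by auto
    obtain L2 where L2: "silver_levels L2" "L2 \<le> L1" "\<forall>i<m. L2 i = L1 i" "settled A \<sigma> L2"
      using settle_one[OF L1(1), of \<sigma> A] insert.prems by auto
    have "\<forall>\<tau>\<in>insert \<sigma> S. settled A \<tau> L2"
      using L1 L2 settled_mono by blast
    then show ?case using L1 L2 order_trans[OF L2(2) L1(2)] by (intro exI[of _ L2]) auto
  qed
  moreover have "finite {\<sigma> :: bool set list. length \<sigma> = m}"
    using finite_lists_length_eq[of "UNIV :: bool set set" m] by simp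
  ultimately obtain L' where "silver_levels L' \<and> L' \<le> L \<and> (\<forall>i<m. L' i = L i) \<and>
      (\<forall>\<sigma>\<in>{\<sigma>. length \<sigma> = m}. settled A \<sigma> L')"
    by (meson subset_refl)
  then show ?thesis by (intro exI[of _ L']) simp
qed

lemma first_splits_bounded:
  assumes "silver_levels L"
  shows "\<exists>N. first_splits k L \<subseteq> {..<N}"
proof -
  obtain B where B: "B \<subseteq> splits L" "finite B" "card B = k"
    using infinite_arbitrarily_large[of "splits L" k] assms by (auto simp: silver_levels_def)
  obtain N where N: "B \<subseteq> {..<N}" using B(2) finite_nat_iff_bounded by blast
  have "i < N" if "i \<in> first_splits k L" for i
  proof (rule ccontr)
    assume "\<not> i < N"
    then have "B \<subseteq> splits L \<inter> {..<i}" using B(1) N by auto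
    then have "k \<le> card (splits L \<inter> {..<i})" using card_mono B(3) by blast
    then show False using that by (simp add: first_splits_def)
  qed
  then show ?thesis by blast
qed

text \<open>
  Settling the stems of a length beyond \<open>n\<close> and beyond the first \<open>k\<close> splitting levels changes
  neither the stem of length \<open>n\<close> nor these levels, so it is a step of a fusion. Letting \<open>j\<close> run through a fusion sequence makes the
  settled lengths unbounded.
\<close>

lemma settle_stage:
  fixes j :: nat
  assumes L: "silver_levels L"
  shows "\<exists>L' m. j \<le> m \<and> fusion_le n k L' L \<and> (\<forall>\<sigma>. length \<sigma> = m \<longrightarrow> settled A \<sigma> L')"
proof -
  obtain N where N: "first_splits k L \<subseteq> {..<N}" using first_splits_bounded[OF L] by blast
  define m where "m = max N (max n j)"
  obtain L' where L': "silver_levels L'" "L' \<le> L" "\<forall>i<m. L' i = L i"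
    "\<forall>\<sigma>. length \<sigma> = m \<longrightarrow> settled A \<sigma> L'"
    using settle_length[OF L, of m A] by (elim exE conjE)
  have "first_splits k L \<subseteq> splits L'"
  proof
    fix i assume i: "i \<in> first_splits k L"
    then have "i < m" using N by (auto simp: m_def)
    then show "i \<in> splits L'" using i L'(3) by (simp add: first_splits_def splits_def)
  qed
  then have "fusion_le n k L' L" using L L' by (simp add: fusion_le_def m_def)
  then show ?thesis using L'(4) by (intro exI[of _ L'] exI[of _ m]) (simp add: m_def)
qed

text \<open>
  The set \<open>C \<sigma>\<close> collects the elements of \<open>A\<close> that \<open>\<sigma>\<close> reaches with the full reservoir; it has at
  most one element, as two would be compatible. Every element compatible with the fusion limit is
  reached in this way.
\<close>

lemma AV_fusion_antichain:
  assumes A: "antichain AV AV_le A" and b: "b \<in> AV"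
  shows "\<exists>b'\<in>AV. (b', b) \<in> AV_fusion k \<and> countable {a \<in> A. compatible AV AV_le a b'}"
proof -
  have unique: "a = a'" if "a \<in> A" "a' \<in> A" "c \<in> AV" "(c, a) \<in> AV_le" "(c, a') \<in> AV_le" for a a' c
    using A that unfolding antichain_def compatible_def by blast
  obtain n L0 where L0: "silver_levels L0" "b = condition n L0"
    using b AV_obtain_condition by blast
  have "\<exists>L. \<forall>j. (silver_levels (L j) \<and> (j = 0 \<longrightarrow> L j = L0)) \<and>
      (\<exists>m\<ge>j. fusion_le n (k + j) (L (Suc j)) (L j) \<and>
         (\<forall>\<sigma>. length \<sigma> = m \<longrightarrow> settled A \<sigma> (L (Suc j))))"
  proof (rule dependent_nat_choice)
    show "\<exists>L. silver_levels L \<and> ((0::nat) = 0 \<longrightarrow> L = L0)" using L0 by blast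
  next
    fix L and j :: nat assume "silver_levels L \<and> (j = 0 \<longrightarrow> L = L0)"
    then obtain L' m where "j \<le> m" "fusion_le n (k + j) L' L"
      "\<forall>\<sigma>. length \<sigma> = m \<longrightarrow> settled A \<sigma> L'"
      using settle_stage by blast
    then show "\<exists>L'. (silver_levels L' \<and> (Suc j = 0 \<longrightarrow> L' = L0)) \<and>
      (\<exists>m\<ge>j. fusion_le n (k + j) L' L \<and> (\<forall>\<sigma>. length \<sigma> = m \<longrightarrow> settled A \<sigma> L'))"
      by (auto simp: fusion_le_def)
  qed
  then obtain L where L: "\<And>j. silver_levels (L j)" "L 0 = L0"
    "\<And>j. fusion_le n (k + j) (L (Suc j)) (L j)"
    "\<And>j. \<exists>m\<ge>j. \<forall>\<sigma>. length \<sigma> = m \<longrightarrow> settled A \<sigma> (L (Suc j))"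
    by metis
  define K where "K = (\<lambda>i. \<Inter>j. L j i)"
  have K: "fusion_le n (k + j) K (L j)" for j
    unfolding K_def by (rule fusion) (rule L(3))
  have K_silver: "silver_levels K" and K_le: "K \<le> L j" for j
    using K by (auto simp: fusion_le_def)
  have settled_K: "\<exists>m\<ge>j. \<forall>\<sigma>. length \<sigma> = m \<longrightarrow> settled A \<sigma> K" for j
    using L(4)[of j] settled_mono[OF _ K_le K_silver L(1)] by blast
  define C where "C \<sigma> = {a \<in> A. silver_levels (graft \<sigma> K) \<and>
    (condition (length \<sigma>) (graft \<sigma> K), a) \<in> AV_le}" for \<sigma>
  have "{a \<in> A. compatible AV AV_le a (condition n K)} \<subseteq> (\<Union>\<sigma>. C \<sigma>)"
  proof
    fix a assume "a \<in> {a \<in> A. compatible AV AV_le a (condition n K)}"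
    then obtain c where a: "a \<in> A" and c: "c \<in> AV" "(c, a) \<in> AV_le" "(c, condition n K) \<in> AV_le"
      by (auto simp: compatible_def)
    obtain j M where M: "silver_levels M" "c = condition j M"
      using c(1) AV_obtain_condition by blast
    have "M \<le> K" using c(3) M K_silver by (simp add: AV_le_condition_iff)
    obtain m where m: "j \<le> m" "\<And>\<sigma>. length \<sigma> = m \<Longrightarrow> settled A \<sigma> K"
      using settled_K by blast
    define \<sigma> where "\<sigma> = map M [0..<m]"
    have \<sigma>: "length \<sigma> = m" "\<And>i. i < m \<Longrightarrow> M i = \<sigma> ! i" by (simp_all add: \<sigma>_def)
    have M_le: "M \<le> graft \<sigma> K"
      using \<open>M \<le> K\<close> \<sigma> by (auto simp: graft_def le_fun_def)
    have graft: "silver_levels (graft \<sigma> K)"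
      using silver_levels_graft[OF K_silver M(1)] \<sigma> by simp
    \<comment> \<open>Lengthening the stem of \<open>c\<close> to \<open>m\<close> without thinning strengthens \<open>c\<close>, so the result is
      still below \<open>a\<close>, and its stem \<open>\<sigma>\<close> has a settled length.\<close>
    have "(condition m M, c) \<in> AV_le" using M m(1) by (simp add: AV_le_condition_iff)
    then have Ma: "(condition m M, a) \<in> AV_le" using c(2) AV_le_trans by blast
    then have "below A m M" using a by (auto simp: below_def)
    then have "below A m (graft \<sigma> K)"
      using m(2)[OF \<sigma>(1)] M(1) M_le \<sigma> unfolding settled_def by blast
    then obtain a' where a': "a' \<in> A" "(condition m (graft \<sigma> K), a') \<in> AV_le"
      by (auto simp: below_def)
    have "(condition m M, condition m (graft \<sigma> K)) \<in> AV_le"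
      using M(1) graft M_le \<sigma> by (simp add: AV_le_condition_iff graft_def)
    then have "(condition m M, a') \<in> AV_le" using a'(2) AV_le_trans by blast
    then have "a = a'" using unique[OF a a'(1) condition_in_AV[OF M(1)] Ma] by blast
    then have "a \<in> C \<sigma>" using a a'(2) graft \<sigma>(1) by (simp add: C_def)
    then show "a \<in> (\<Union>\<sigma>. C \<sigma>)" by blast
  qed
  moreover have "countable (C \<sigma>)" for \<sigma>
  proof -
    have "a = a'" if "a \<in> C \<sigma>" "a' \<in> C \<sigma>" for a a'
      using that unique condition_in_AV unfolding C_def by blast
    then have "C \<sigma> = {} \<or> (\<exists>a. C \<sigma> = {a})" by blast
    then show ?thesis by (elim disjE exE) simp_all
  qed
  then have "countable (\<Union>\<sigma>. C \<sigma>)" by (intro countable_UN) auto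
  ultimately have "countable {a \<in> A. compatible AV AV_le a (condition n K)}"
    by (rule countable_subset)
  moreover have "(condition n K, b) \<in> AV_fusion k"
    using K[of 0] L(2) L0 by (auto simp: AV_fusion_def)
  ultimately show ?thesis using condition_in_AV[OF K_silver] by blast
qed

theorem corollary6:
  shows "axiom_A AV AV_le"
  unfolding axiom_A_def
proof (intro exI[of _ AV_fusion] conjI allI ballI impI)
  show "partial_order_on AV (AV_fusion n)" for n by (rule AV_fusion_partial_order)
  show "(b, a) \<in> AV_fusion n" if "(b, a) \<in> AV_fusion (Suc n)" for a b n
    using that fusion_le_Suc by (fastforce simp: AV_fusion_def)
  show "(b, a) \<in> AV_le" if "(b, a) \<in> AV_fusion (Suc n)" for a b n
    using that by (rule AV_fusion_le)
  show "\<exists>b\<in>AV. \<forall>n. (b, a n) \<in> AV_fusion n"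
    if "(\<forall>n. a n \<in> AV) \<and> (\<forall>n. (a (Suc n), a n) \<in> AV_fusion n)" for a
    using that by (intro AV_fusion_complete) auto
  show "\<exists>b'\<in>AV. (b', b) \<in> AV_fusion n \<and> countable {a \<in> A. compatible AV AV_le a b'}"
    if "maximal_antichain AV AV_le A" "b \<in> AV" for A b n
    using that by (intro AV_fusion_antichain) (auto simp: maximal_antichain_def)
qed

end
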